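(* Let $R$ be a ring, $n\ge 1$, let $\delta:R\to R$ be an endomorphism and let $T=[t_{i,j}]$ be a transitive matrix in $\mathrm{M}_n(\mathrm{Z}(R))$. If $A\in \mathrm{M}_n(R,\delta,T)$, then the preadjoint $A^{\ast}$ of $A$ satisfies $A^{\ast}\in \mathrm{M}_n(R,\delta,T)$. In other words, the supermatrix algebra $\mathrm{M}_n(R,\delta,T)$ is closed with respect to taking the preadjoint.
   Context: A ring means a not necessarily commutative ring with identity; endomorphisms preserve the identity. $\mathrm{Z}(R)$ is the center of $R$ and $\mathrm{M}_n(R)$ the ring of $n\times n$ matrices over $R$. A matrix $T=[t_{i,j}]$ is transitive if $t_{i,i}=1$ and $t_{i,j}t_{j,k}=t_{i,k}$ for all $i,j,k\in\{1,\ldots,n\}$. The supermatrix algebra is $$\mathrm{M}_n(R,\delta,T)=\{A=[a_{i,j}]\in\mathrm{M}_n(R)\mid \delta(a_{i,j})=t_{i,j}a_{i,j}\text{ for all }1\le i,j\le n\}.$$ The preadjoint $A^{\ast}=[a^{\ast}_{r,s}]$ of $A=[a_{i,j}]\in \mathrm{M}_n(R)$ is defined by $$a_{r,s}^{\ast}=\sum_{\tau,\pi}\mathrm{sgn}(\pi)\,a_{\tau(1),\pi(\tau(1))}\cdots a_{\tau(s-1),\pi(\tau(s-1))}\,a_{\tau(s+1),\pi(\tau(s+1))}\cdots a_{\tau(n),\pi(\tau(n))},$$ where the sum is over all $\tau,\pi$ in the symmetric group $\mathrm{S}_n$ with $\tau(s)=s$ and $\pi(s)=r$ (the factors are multiplied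 in the displayed order; an empty product is $1$). *)

theory Defs
  imports
    "HOL-Algebra.Ring"
    "HOL-Combinatorics.Permutations"
    "Jordan_Normal_Form.Matrix"
begin

text \<open>
  Rings are explicit HOL-Algebra structures, so they need not be commutative and the zero ring
  is included. Matrix indices run over \<open>0, \<dots>, n - 1\<close> instead of \<open>1, \<dots>, n\<close>.
\<close>

definition ring_center :: "('a, 'm) ring_scheme \<Rightarrow> 'a set" where
  "ring_center R = {z \<in> carrier R. \<forall>x \<in> carrier R. z \<otimes>\<^bsub>R\<^esub> x = x \<otimes>\<^bsub>R\<^esub> z}"

text \<open>The square matrices with entries in the set \<open>S\<close>: \<open>M_n(R)\<close> is \<open>mats_over (carrier R) n\<close>
  and \<open>M_n(Z(R))\<close> is \<open>mats_over (ring_center R) n\<close>.\<close>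

definition mats_over :: "'a set \<Rightarrow> nat \<Rightarrow> 'a mat set" where
  "mats_over S n = {A \<in> carrier_mat n n. \<forall>i<n. \<forall>j<n. A $$ (i, j) \<in> S}"

definition transitive_mat :: "('a, 'm) ring_scheme \<Rightarrow> nat \<Rightarrow> 'a mat \<Rightarrow> bool" where
  "transitive_mat R n T \<longleftrightarrow>
     (\<forall>i<n. T $$ (i, i) = \<one>\<^bsub>R\<^esub>) \<and>
     (\<forall>i<n. \<forall>j<n. \<forall>k<n. T $$ (i, j) \<otimes>\<^bsub>R\<^esub> T $$ (j, k) = T $$ (i, k))"

definition supermatrix_algebra ::
    "('a, 'm) ring_scheme \<Rightarrow> nat \<Rightarrow> ('a \<Rightarrow> 'a) \<Rightarrow> 'a mat \<Rightarrow> 'a mat set" where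
  "supermatrix_algebra R n \<delta> T =
     {A \<in> mats_over (carrier R) n.
        \<forall>i<n. \<forall>j<n. \<delta> (A $$ (i, j)) = T $$ (i, j) \<otimes>\<^bsub>R\<^esub> A $$ (i, j)}"

definition ordered_prod :: "('a, 'm) ring_scheme \<Rightarrow> 'a list \<Rightarrow> 'a" where
  "ordered_prod R xs = foldr (\<lambda>x y. x \<otimes>\<^bsub>R\<^esub> y) xs \<one>\<^bsub>R\<^esub>"

text \<open>The \<open>(r, s)\<close> entry omits the factor at position \<open>s\<close>. The sign is an integer and acts
  as an integer multiple in the additive group of \<open>R\<close>.\<close>

definition preadjoint :: "('a, 'm) ring_scheme \<Rightarrow> nat \<Rightarrow> 'a mat \<Rightarrow> 'a mat" where
  "preadjoint R n A = mat n n (\<lambda>(r, s).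
     finsum R
       (\<lambda>(\<tau>, \<pi>). [sign \<pi>] \<cdot>\<^bsub>R\<^esub>
         ordered_prod R (map (\<lambda>i. A $$ (\<tau> i, \<pi> (\<tau> i))) ([0..<s] @ [Suc s..<n])))
       {(\<tau>, \<pi>). \<tau> permutes {..<n} \<and> \<pi> permutes {..<n} \<and> \<tau> s = s \<and> \<pi> s = r})"

end

theory Submission
  imports Defs "HOL-Algebra.RingHom"
begin

text \<open>
  Write \<open>t(i, j)\<close> for the entries of \<open>T\<close>. Transitivity gives \<open>t(i, j) = t(i, 0) t(0, j)\<close> and
  \<open>t(i, 0) t(0, i) = 1\<close>, so for a permutation \<open>\<pi>\<close> the product of all \<open>t(i, \<pi>(i))\<close> is \<open>1\<close>, and
  leaving out the factor \<open>t(s, r)\<close> with \<open>r = \<pi>(s)\<close> leaves its inverse \<open>t(r, s)\<close>. As the entries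
  of \<open>T\<close> are central, applying \<open>\<delta>\<close> to a summand of the \<open>(r, s)\<close> entry of the preadjoint
  multiplies it by exactly this product.
\<close>

text \<open>\<open>finprod\<close> is only meaningful over a commutative monoid, which
  \<open>R\<close> need not be. Shrinking just the carrier keeps the operations of \<open>R\<close>,
  so products formed in the center can be multiplied with arbitrary elements of
  \<open>R\<close>.\<close>

abbreviation center_ring :: "('a, 'm) ring_scheme \<Rightarrow> ('a, 'm) ring_scheme" where
  "center_ring R \<equiv> R\<lparr>carrier := ring_center R\<rparr>"

lemma ring_center_carrier: "x \<in> ring_center R \<Longrightarrow> x \<in> carrier R"
  by (simp add: ring_center_def)

lemma ring_center_commute:
  "x \<in> ring_center R \<Longrightarrow> z \<in> carrier R \<Longrightarrow> x \<otimes>\<^bsub>R\<^esub> z = z \<otimes>\<^bsub>R\<^esub> x"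
  unfolding ring_center_def by blast

lemma (in ring) center_mult:
  assumes x: "x \<in> ring_center R" and y: "y \<in> ring_center R"
  shows "x \<otimes> y \<in> ring_center R"
proof -
  have c: "x \<in> carrier R" "y \<in> carrier R"
    using x y by (simp_all add: ring_center_carrier)
  have "(x \<otimes> y) \<otimes> z = z \<otimes> (x \<otimes> y)" if z: "z \<in> carrier R" for z
  proof -
    have "(x \<otimes> y) \<otimes> z = x \<otimes> (y \<otimes> z)"
      using c z by (simp add: m_assoc)
    also have "y \<otimes> z = z \<otimes> y"
      using y z by (rule ring_center_commute)
    also have "x \<otimes> (z \<otimes> y) = (x \<otimes> z) \<otimes> y"
      using c z by (simp add: m_assoc)
    also have "x \<otimes> z = z \<otimes> x"
      using x z by (rule ring_center_commute)
    finally show ?thesis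
      using c z by (simp add: m_assoc)
  qed
  with c show ?thesis
    unfolding ring_center_def by blast
qed

lemma (in ring) center_one: "\<one> \<in> ring_center R"
  by (simp add: ring_center_def)

lemma (in ring) center_comm_monoid: "comm_monoid (center_ring R)"
proof (rule comm_monoidI)
  fix x y z
  assume "x \<in> carrier (center_ring R)" "y \<in> carrier (center_ring R)"
    "z \<in> carrier (center_ring R)"
  then show "x \<otimes>\<^bsub>center_ring R\<^esub> y \<otimes>\<^bsub>center_ring R\<^esub> z =
      x \<otimes>\<^bsub>center_ring R\<^esub> (y \<otimes>\<^bsub>center_ring R\<^esub> z)"
    by (simp add: ring_center_carrier m_assoc)
next
  fix x y
  assume "x \<in> carrier (center_ring R)" "y \<in> carrier (center_ring R)"
  then show "x \<otimes>\<^bsub>center_ring R\<^esub> y = y \<otimes>\<^bsub>center_ring R\<^esub> x"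
    by (simp add: ring_center_commute[of x] ring_center_carrier)
qed (simp_all add: center_mult center_one ring_center_carrier)

section \<open>Ordered products, homomorphisms and central factors\<close>

lemma (in ring) ordered_prod_closed:
  "f \<in> set xs \<rightarrow> carrier R \<Longrightarrow> ordered_prod R (map f xs) \<in> carrier R"
  by (induction xs) (auto simp: ordered_prod_def)

lemma (in ring_hom_ring) hom_ordered_prod:
  "f \<in> set xs \<rightarrow> carrier R \<Longrightarrow>
     h (ordered_prod R (map f xs)) = ordered_prod S (map (\<lambda>i. h (f i)) xs)"
proof (induction xs)
  case (Cons x xs)
  then show ?case
    using R.ordered_prod_closed[of f xs] by (auto simp: ordered_prod_def)
qed (simp add: ordered_prod_def)

text \<open>Finiteness is not assumed: over an infinite index set both sums are zero by convention,
  and \<open>h\<close> preserves zero.\<close>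

lemma (in ring_hom_ring) hom_finsum:
  "f \<in> A \<rightarrow> carrier R \<Longrightarrow> h (finsum R f A) = finsum S (\<lambda>i. h (f i)) A"
  by (induction A rule: infinite_finite_induct) (auto simp: Pi_def)

text \<open>Integer multiples are powers in the additive group, and \<open>h\<close> is a
  homomorphism of additive groups. This carries \<open>\<delta>\<close> past the sign of a
  permutation.\<close>

lemma (in ring_hom_ring) hom_add_pow_int:
  "x \<in> carrier R \<Longrightarrow> h ([(k :: int)] \<cdot> x) = [k] \<cdot>\<^bsub>S\<^esub> h x"
  using group_hom.hom_int_pow[OF a_group_hom, of x k] by (simp add: add_pow_def)

text \<open>Central factors can be pulled to the front one by one, while the \<open>f i\<close> keep
  their order. Distinctness matters because \<open>finprod\<close> ranges over a set and would count
  a repeated index once.\<close>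

lemma (in ring) ordered_prod_central:
  assumes "distinct xs" "c \<in> set xs \<rightarrow> ring_center R" "f \<in> set xs \<rightarrow> carrier R"
  shows "ordered_prod R (map (\<lambda>i. c i \<otimes> f i) xs) =
           finprod (center_ring R) c (set xs) \<otimes> ordered_prod R (map f xs)"
  using assms
proof (induction xs)
  case Nil
  then show ?case
    by (simp add: ordered_prod_def comm_monoid.finprod_empty[OF center_comm_monoid])
next
  case (Cons x xs)
  interpret Z: comm_monoid "center_ring R"
    by (rule center_comm_monoid)
  let ?P = "finprod (center_ring R) c (set xs)" and ?Q = "ordered_prod R (map f xs)"
  have Z: "?P \<in> ring_center R"
    using Z.finprod_closed[of c "set xs"] Cons.prems by simp
  then have P: "?P \<in> carrier R"
    by (rule ring_center_carrier)
  have c: "c x \<in> carrier R" and f: "f x \<in> carrier R" and Q: "?Q \<in> carrier R"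
    using Cons.prems by (auto simp: ring_center_carrier intro!: ordered_prod_closed)
  have "ordered_prod R (map (\<lambda>i. c i \<otimes> f i) (x # xs)) = (c x \<otimes> f x) \<otimes> (?P \<otimes> ?Q)"
    using Cons by (auto simp: ordered_prod_def)
  also have "\<dots> = c x \<otimes> (f x \<otimes> ?P) \<otimes> ?Q"
    using P c f Q by (simp add: m_assoc)
  \<comment> \<open>The only commutation: the product gathered from the tail is central and moves to
    the left of \<open>f x\<close>.\<close>
  also have "\<dots> = (c x \<otimes> ?P) \<otimes> (f x \<otimes> ?Q)"
    using P ring_center_commute[OF Z f, symmetric] c f Q by (simp add: m_assoc)
  also have "c x \<otimes> ?P = finprod (center_ring R) c (set (x # xs))"
    using Cons.prems by (simp add: Pi_iff)
  finally show ?case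
    by (simp add: ordered_prod_def)
qed

section \<open>Products of entries of a transitive matrix along a permutation\<close>

lemma transitive_finprod_permutes:
  assumes "ring R" "T \<in> mats_over (ring_center R) n" "transitive_mat R n T"
    and p: "p permutes {..<n}"
  shows "finprod (center_ring R) (\<lambda>i. T $$ (i, p i)) {..<n} = \<one>\<^bsub>R\<^esub>"
proof (cases "n = 0")
  case True
  then show ?thesis
    using comm_monoid.finprod_empty[OF ring.center_comm_monoid[OF assms(1)]] by simp
next
  case False
  interpret Z: comm_monoid "center_ring R"
    by (rule ring.center_comm_monoid[OF assms(1)])
  have T: "T $$ (i, j) \<in> ring_center R" if "i < n" "j < n" for i j
    using assms(2) that by (simp add: mats_over_def)
  have tr: "T $$ (i, j) \<otimes>\<^bsub>R\<^esub> T $$ (j, k) = T $$ (i, k)" if "i < n" "j < n" "k < n" for i j k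
    using assms(3) that by (simp add: transitive_mat_def)
  have id: "T $$ (i, i) = \<one>\<^bsub>R\<^esub>" if "i < n" for i
    using assms(3) that by (simp add: transitive_mat_def)
  have pn: "p i < n" if "i < n" for i
    using permutes_in_image[OF p, of i] that by simp
  let ?prod = "\<lambda>f. finprod (center_ring R) f {..<n}"
  \<comment> \<open>Every entry is factored through the pivot index 0, which is a valid index
    because \<open>n\<close> is positive here.\<close>
  have "?prod (\<lambda>i. T $$ (i, p i)) = ?prod (\<lambda>i. T $$ (i, 0) \<otimes>\<^bsub>center_ring R\<^esub> T $$ (0, p i))"
    using False by (intro Z.finprod_cong') (auto simp: tr pn T)
  also have "\<dots> = ?prod (\<lambda>i. T $$ (i, 0)) \<otimes>\<^bsub>center_ring R\<^esub> ?prod (\<lambda>i. T $$ (0, p i))"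
    using False by (intro Z.finprod_multf) (auto simp: pn T)
  \<comment> \<open>After the split only the second product involves \<open>p\<close>, and
    reindexing along the bijection \<open>p\<close> removes it.\<close>
  also have "?prod (\<lambda>i. T $$ (0, p i)) = ?prod (\<lambda>i. T $$ (0, i))"
    using False Z.finprod_reindex[of "\<lambda>i. T $$ (0, i)" p "{..<n}"]
    by (auto simp: T permutes_image[OF p] permutes_inj_on[OF p])
  also have "?prod (\<lambda>i. T $$ (i, 0)) \<otimes>\<^bsub>center_ring R\<^esub> ?prod (\<lambda>i. T $$ (0, i)) =
      ?prod (\<lambda>i. T $$ (i, 0) \<otimes>\<^bsub>center_ring R\<^esub> T $$ (0, i))"
    using False by (intro Z.finprod_multf[symmetric]) (auto simp: T)
  also have "\<dots> = \<one>\<^bsub>center_ring R\<^esub>"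
    using False by (intro Z.finprod_one_eqI) (auto simp: tr id)
  finally show ?thesis
    by simp
qed

text \<open>Since \<open>q\<close> fixes \<open>s\<close>, it permutes the remaining indices and can
  be reindexed away. What is left is the full product, equal to one, without its factor at
  \<open>s\<close>, hence the inverse of that factor.\<close>

lemma transitive_finprod_permutes_omit:
  assumes "ring R" "T \<in> mats_over (ring_center R) n" "transitive_mat R n T"
    and q: "q permutes {..<n}" and p: "p permutes {..<n}" and s: "s < n" "q s = s"
  shows "finprod (center_ring R) (\<lambda>i. T $$ (q i, p (q i))) ({..<n} - {s}) = T $$ (p s, s)"
proof -
  interpret Z: comm_monoid "center_ring R"
    by (rule ring.center_comm_monoid[OF assms(1)])
  have pn: "p i < n" if "i < n" for i
    using permutes_in_image[OF p, of i] that by simp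
  have T: "T $$ (i, j) \<in> ring_center R" if "i < n" "j < n" for i j
    using assms(2) that by (simp add: mats_over_def)
  let ?P = "finprod (center_ring R) (\<lambda>i. T $$ (i, p i)) ({..<n} - {s})"
  have PT: "(\<lambda>i. T $$ (i, p i)) \<in> {..<n} - {s} \<rightarrow> carrier (center_ring R)"
    by (auto simp: T pn)
  then have P: "?P \<in> carrier (center_ring R)"
    by (rule Z.finprod_closed)
  have qim: "q ` ({..<n} - {s}) = {..<n} - {s}"
    using s by (simp add: image_set_diff[OF permutes_inj[OF q]] permutes_image[OF q])
  have red: "finprod (center_ring R) (\<lambda>i. T $$ (q i, p (q i))) ({..<n} - {s}) = ?P"
    using Z.finprod_reindex[of "\<lambda>i. T $$ (i, p i)" q "{..<n} - {s}"] PT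
    by (simp add: qim permutes_inj_on[OF q])
  have "finprod (center_ring R) (\<lambda>i. T $$ (i, p i)) (insert s ({..<n} - {s})) =
      T $$ (s, p s) \<otimes>\<^bsub>center_ring R\<^esub> ?P"
    using PT s by (intro Z.finprod_insert) (auto simp: T pn)
  moreover have "insert s ({..<n} - {s}) = {..<n}"
    using s by auto
  ultimately have 1: "T $$ (s, p s) \<otimes>\<^bsub>center_ring R\<^esub> ?P = \<one>\<^bsub>center_ring R\<^esub>"
    using transitive_finprod_permutes[OF assms(1-3) p] by simp
  have 2: "T $$ (p s, s) \<otimes>\<^bsub>center_ring R\<^esub> T $$ (s, p s) = \<one>\<^bsub>center_ring R\<^esub>"
    using assms(3) s pn by (simp add: transitive_mat_def)
  \<comment> \<open>Both sides invert \<open>T $$ (s, p s)\<close>, one from the right and one from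
    the left, so they coincide.\<close>
  have "?P = T $$ (p s, s)"
    using Z.inv_unique[OF 2 1] P s by (simp add: T pn)
  with red show ?thesis
    by simp
qed

theorem theorem4p1:
  fixes R :: "('a, 'm) ring_scheme" and n :: nat
    and \<delta> :: "'a \<Rightarrow> 'a" and T A :: "'a mat"
  assumes "ring R"
    and "n \<ge> 1"
    and "\<delta> \<in> ring_hom R R"
    and "T \<in> mats_over (ring_center R) n"
    and "transitive_mat R n T"
    and "A \<in> supermatrix_algebra R n \<delta> T"
  shows "preadjoint R n A \<in> supermatrix_algebra R n \<delta> T"
proof -
  interpret ring_hom_ring R R \<delta>
    using assms(1,1,3) by (rule ring_hom_ringI2)
  have A: "A $$ (i, j) \<in> carrier R" "\<delta> (A $$ (i, j)) = T $$ (i, j) \<otimes>\<^bsub>R\<^esub> A $$ (i, j)"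
    if "i < n" "j < n" for i j
    using assms(6) that by (auto simp: supermatrix_algebra_def mats_over_def)
  have T: "T $$ (i, j) \<in> ring_center R" "T $$ (i, j) \<in> carrier R" if "i < n" "j < n" for i j
    using assms(4) that by (simp_all add: mats_over_def ring_center_carrier)
  have "preadjoint R n A $$ (r, s) \<in> carrier R \<and>
      \<delta> (preadjoint R n A $$ (r, s)) = T $$ (r, s) \<otimes>\<^bsub>R\<^esub> preadjoint R n A $$ (r, s)"
    if r: "r < n" and s: "s < n" for r s
  proof -
    let ?L = "[0..<s] @ [Suc s..<n]"
    define I where
      "I = {(\<tau>, \<pi>). \<tau> permutes {..<n} \<and> \<pi> permutes {..<n} \<and> \<tau> s = s \<and> \<pi> s = r}"
    define Q where "Q \<tau> \<pi> = ordered_prod R (map (\<lambda>i. A $$ (\<tau> i, \<pi> (\<tau> i))) ?L)" for \<tau> \<pi>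
    define F where "F = (\<lambda>(\<tau>, \<pi>). [sign \<pi>] \<cdot>\<^bsub>R\<^esub> Q \<tau> \<pi>)"
    have entry: "preadjoint R n A $$ (r, s) = finsum R F I"
      using r s by (simp add: preadjoint_def F_def Q_def I_def)
    \<comment> \<open>Finiteness of the index set is what later allows \<open>T $$ (r, s)\<close> to
      be taken out of the sum.\<close>
    have "I \<subseteq> {p. p permutes {..<n}} \<times> {p. p permutes {..<n}}"
      by (auto simp: I_def)
    then have fin: "finite I"
      by (rule finite_subset) (simp add: finite_permutations)
    have L: "set ?L = {..<n} - {s}" "distinct ?L"
      using s by auto
    \<comment> \<open>The scaling factor depends on \<open>r\<close> and \<open>s\<close> alone, not
      on the pair of permutations, so it is common to all summands.\<close>
    have summand: "F x \<in> carrier R \<and> \<delta> (F x) = T $$ (r, s) \<otimes>\<^bsub>R\<^esub> F x" if xI: "x \<in> I" for x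
    proof -
      obtain \<tau> \<pi> where x: "x = (\<tau>, \<pi>)" and \<tau>: "\<tau> permutes {..<n}" "\<tau> s = s"
        and \<pi>: "\<pi> permutes {..<n}" "\<pi> s = r"
        using xI by (auto simp: I_def)
      have bnd: "\<tau> i < n" "\<pi> (\<tau> i) < n" if "i \<in> set ?L" for i
        using that permutes_in_image[OF \<tau>(1), of i] permutes_in_image[OF \<pi>(1), of "\<tau> i"]
        unfolding L by auto
      have fA: "(\<lambda>i. A $$ (\<tau> i, \<pi> (\<tau> i))) \<in> set ?L \<rightarrow> carrier R"
        by (intro Pi_I A(1) bnd)
      have fT: "(\<lambda>i. T $$ (\<tau> i, \<pi> (\<tau> i))) \<in> set ?L \<rightarrow> ring_center R"
        by (intro Pi_I T(1) bnd)
      have Q: "Q \<tau> \<pi> \<in> carrier R"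
        unfolding Q_def by (rule R.ordered_prod_closed[OF fA])
      have "\<delta> (Q \<tau> \<pi>) = ordered_prod R (map (\<lambda>i. \<delta> (A $$ (\<tau> i, \<pi> (\<tau> i)))) ?L)"
        unfolding Q_def by (rule hom_ordered_prod[OF fA])
      also have "map (\<lambda>i. \<delta> (A $$ (\<tau> i, \<pi> (\<tau> i)))) ?L =
          map (\<lambda>i. T $$ (\<tau> i, \<pi> (\<tau> i)) \<otimes>\<^bsub>R\<^esub> A $$ (\<tau> i, \<pi> (\<tau> i))) ?L"
        by (intro map_cong refl A(2) bnd)
      also have "ordered_prod R \<dots> =
          finprod (center_ring R) (\<lambda>i. T $$ (\<tau> i, \<pi> (\<tau> i))) (set ?L) \<otimes>\<^bsub>R\<^esub> Q \<tau> \<pi>"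
        unfolding Q_def by (rule R.ordered_prod_central[OF L(2) fT fA])
      \<comment> \<open>The list skips exactly position \<open>s\<close>, and
        \<open>\<pi> s = r\<close> turns the inverse of the missing factor into
        \<open>T $$ (r, s)\<close>.\<close>
      also have "finprod (center_ring R) (\<lambda>i. T $$ (\<tau> i, \<pi> (\<tau> i))) (set ?L) = T $$ (r, s)"
        using transitive_finprod_permutes_omit[OF assms(1,4,5) \<tau>(1) \<pi>(1) s \<tau>(2)] \<pi>(2)
        unfolding L by simp
      finally have "\<delta> (Q \<tau> \<pi>) = T $$ (r, s) \<otimes>\<^bsub>R\<^esub> Q \<tau> \<pi>" .
      \<comment> \<open>The sign is an integer multiple, so it passes through
        \<open>\<delta>\<close> and through multiplication by \<open>T $$ (r, s)\<close>.\<close>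
      then show ?thesis
        using Q T(2)[OF r s]
        by (simp add: x F_def hom_add_pow_int R.add_pow_rdistr_int)
    qed
    then have F: "F \<in> I \<rightarrow> carrier R"
      by blast
    have "\<delta> (finsum R F I) = finsum R (\<lambda>x. \<delta> (F x)) I"
      by (rule hom_finsum[OF F])
    also have "\<dots> = finsum R (\<lambda>x. T $$ (r, s) \<otimes>\<^bsub>R\<^esub> F x) I"
      using summand T(2)[OF r s] by (intro R.finsum_cong') auto
    also have "\<dots> = T $$ (r, s) \<otimes>\<^bsub>R\<^esub> finsum R F I"
      by (rule R.finsum_rdistr[OF fin T(2)[OF r s] F, symmetric])
    finally show ?thesis
      using F by (simp add: entry)
  qed
  moreover have "preadjoint R n A \<in> carrier_mat n n"
    by (simp add: preadjoint_def)
  ultimately show ?thesis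
    by (simp add: supermatrix_algebra_def mats_over_def)
qed

end
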